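(* Let $S\subset \mathbb{Z}^n$ be a realizable set. Then all realizations of $S$ are equivalent if and only if for every $x,y\in S$ with $\max_{i\in [n]}|x_i-y_i|=1$ there exists $i\in[n]$ such that either $x_i<y_i$ and $\{z\in D_S(y): z_i=y_i-1\}=\{x\}$, or $y_i<x_i$ and $\{z\in D_S(x): z_i=x_i-1\}=\{y\}$.
   Context: All graphs are finite, simple and connected. For a graph $G$ and an ordered vertex subset $W=\{\omega^1,\dots,\omega^n\}$, $r(u\mid W)=(d(u,\omega^1),\dots,d(u,\omega^n))$; $W$ is resolving if these vectors are pairwise distinct. A finite $S\subset\mathbb{Z}^n$ is realizable if there is a graph $G$ and resolving set $W$ with $S=\{r(u\mid W):u\in V(G)\}$; $(G,W)$ is a realization of $S$. Two realizations $(G,W)$ and $(G',W')$ of $S$ are equivalent if the map $f:V(G)\to V(G')$ with $r(u\mid W)=r(f(u)\mid W')$ is a graph isomorphism. For $x\in\mathbb{Z}^n$, $D_S(x)=\{y\in S: \max_{i\in[n]}|x_i-y_i|=1\}$. *)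

theory Defs
  imports
    "HOL-Analysis.Finite_Cartesian_Product"
    "Graph_Theory.Digraph_Component"
begin

text \<open>
  Finite simple graphs are the \<open>pair_graph\<close>s of \<open>Graph_Theory\<close>: finite, loop-free
  and with a symmetric arc set, an edge being represented by its two opposite arcs.
  \<open>Digraph_Component.connected\<close> includes that the vertex set is nonempty; the
  qualifier distinguishes it from topological connectedness.
\<close>

definition connected_graph :: "'v pair_pre_digraph \<Rightarrow> bool" where
  "connected_graph G \<longleftrightarrow> pair_graph G \<and> Digraph_Component.connected (with_proj G)"

text \<open>
  Only used for vertices joined by some walk; \<open>LEAST\<close> is unspecified otherwise.
\<close>

definition graph_dist :: "'v pair_pre_digraph \<Rightarrow> 'v \<Rightarrow> 'v \<Rightarrow> nat" where
  "graph_dist G u v = (LEAST k. \<exists>p. pre_digraph.awalk (with_proj G) u p v \<and> length p = k)"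

text \<open>
  An ordered vertex subset with \<open>n\<close> elements is an injective family \<open>w\<close> of vertices
  indexed by a finite type \<open>'n\<close>, where \<open>n\<close> is \<open>CARD('n)\<close>.
\<close>

definition metric_rep :: "'v pair_pre_digraph \<Rightarrow> ('n::finite \<Rightarrow> 'v) \<Rightarrow> 'v \<Rightarrow> int ^ 'n" where
  "metric_rep G w u = (\<chi> i. int (graph_dist G u (w i)))"

definition resolving :: "'v pair_pre_digraph \<Rightarrow> ('n::finite \<Rightarrow> 'v) \<Rightarrow> bool" where
  "resolving G w \<longleftrightarrow> inj w \<and> range w \<subseteq> pverts G \<and> inj_on (metric_rep G w) (pverts G)"

definition realization ::
    "(int ^ 'n::finite) set \<Rightarrow> 'v pair_pre_digraph \<Rightarrow> ('n \<Rightarrow> 'v) \<Rightarrow> bool" where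
  "realization S G w \<longleftrightarrow>
     connected_graph G \<and> resolving G w \<and> S = metric_rep G w ` pverts G"

definition graph_isomorphism ::
    "('u \<Rightarrow> 'v) \<Rightarrow> 'u pair_pre_digraph \<Rightarrow> 'v pair_pre_digraph \<Rightarrow> bool" where
  "graph_isomorphism f G H \<longleftrightarrow>
     bij_betw f (pverts G) (pverts H) \<and>
     (\<forall>u\<in>pverts G. \<forall>v\<in>pverts G. (u, v) \<in> parcs G \<longleftrightarrow> (f u, f v) \<in> parcs H)"

text \<open>
  For two realizations of the same set, the map \<open>f\<close> below is uniquely determined on the
  vertices of \<open>G\<close>, because \<open>w'\<close> resolves \<open>G'\<close>.
\<close>

definition equivalent_realizations ::
    "'u pair_pre_digraph \<Rightarrow> ('n::finite \<Rightarrow> 'u) \<Rightarrow> 'v pair_pre_digraph \<Rightarrow> ('n \<Rightarrow> 'v) \<Rightarrow> bool" where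
  "equivalent_realizations G w G' w' \<longleftrightarrow>
     (\<exists>f. (\<forall>u\<in>pverts G. f u \<in> pverts G' \<and> metric_rep G w u = metric_rep G' w' (f u)) \<and>
          graph_isomorphism f G G')"

text \<open>
  The vertices are taken to be natural numbers, which is no restriction for finite graphs:
  see \<open>realizableI\<close> and \<open>all_realizations_equivalentD\<close> below.
\<close>

definition realizable :: "(int ^ 'n::finite) set \<Rightarrow> bool" where
  "realizable S \<longleftrightarrow>
     finite S \<and> (\<exists>(G :: nat pair_pre_digraph) (w :: 'n \<Rightarrow> nat). realization S G w)"

definition all_realizations_equivalent :: "(int ^ 'n::finite) set \<Rightarrow> bool" where
  "all_realizations_equivalent S \<longleftrightarrow>
     (\<forall>(G :: nat pair_pre_digraph) (w :: 'n \<Rightarrow> nat) (G' :: nat pair_pre_digraph) (w' :: 'n \<Rightarrow> nat).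
        realization S G w \<longrightarrow> realization S G' w' \<longrightarrow> equivalent_realizations G w G' w')"

definition max_dist :: "int ^ 'n::finite \<Rightarrow> int ^ 'n \<Rightarrow> int" where
  "max_dist x y = Max (range (\<lambda>i. \<bar>x $ i - y $ i\<bar>))"

definition D :: "(int ^ 'n::finite) set \<Rightarrow> int ^ 'n \<Rightarrow> (int ^ 'n) set" where
  "D S x = {y \<in> S. max_dist x y = 1}"


subsection \<open>Independence of the type of vertices\<close>

definition relabel :: "('u \<Rightarrow> 'v) \<Rightarrow> 'u pair_pre_digraph \<Rightarrow> 'v pair_pre_digraph" where
  "relabel f G = \<lparr>pverts = f ` pverts G, parcs = map_prod f f ` parcs G\<rparr>"

lemma relabel_simps [simp]:
  "pverts (relabel f G) = f ` pverts G"
  "parcs (relabel f G) = map_prod f f ` parcs G"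
  by (simp_all add: relabel_def)

lemma awalk_relabel:
  assumes "pre_digraph.awalk (with_proj G) u p v"
  shows "pre_digraph.awalk (with_proj (relabel f G)) (f u) (map (map_prod f f) p) (f v)"
proof -
  have "pcas u p v \<Longrightarrow> pcas (f u) (map (map_prod f f) p) (f v)" for u
    by (induction p arbitrary: u) auto
  then show ?thesis
    using assms by (auto simp: pre_digraph.awalk_def cas_with_proj_eq)
qed

lemma pair_wf_relabel:
  assumes "pair_wf_digraph G"
  shows "pair_wf_digraph (relabel f G)"
  using assms by (auto simp: pair_wf_digraph_def)

lemma relabel_inv:
  assumes "pair_wf_digraph G" "inj_on f (pverts G)"
  shows "relabel (inv_into (pverts G) f) (relabel f G) = G"
proof -
  interpret pair_wf_digraph G by fact
  let ?g = "inv_into (pverts G) f"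
  have v: "?g ` f ` pverts G = pverts G"
    using assms(2) by force
  have "map_prod ?g ?g (map_prod f f e) = e" if "e \<in> parcs G" for e
    using that assms(2) arc_fst_in_verts[OF that] arc_snd_in_verts[OF that]
    by (cases e) auto
  then have "map_prod ?g ?g ` map_prod f f ` parcs G = parcs G"
    by (force simp: image_iff)
  with v show ?thesis
    by (simp add: relabel_def)
qed

lemma graph_dist_relabel:
  assumes "pair_wf_digraph G" "inj_on f (pverts G)" "u \<in> pverts G" "v \<in> pverts G"
  shows "graph_dist (relabel f G) (f u) (f v) = graph_dist G u v"
proof -
  let ?g = "inv_into (pverts G) f"
  have "(\<exists>p. pre_digraph.awalk (with_proj (relabel f G)) (f u) p (f v) \<and> length p = k) \<longleftrightarrow>
        (\<exists>p. pre_digraph.awalk (with_proj G) u p v \<and> length p = k)" for k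
  proof
    assume "\<exists>p. pre_digraph.awalk (with_proj (relabel f G)) (f u) p (f v) \<and> length p = k"
    then obtain p where p: "pre_digraph.awalk (with_proj (relabel f G)) (f u) p (f v)" "length p = k"
      by blast
    from awalk_relabel[OF p(1), of ?g] show "\<exists>p. pre_digraph.awalk (with_proj G) u p v \<and> length p = k"
      using p(2) assms by (auto simp: relabel_inv intro!: exI[of _ "map (map_prod ?g ?g) p"])
  next
    assume "\<exists>p. pre_digraph.awalk (with_proj G) u p v \<and> length p = k"
    then show "\<exists>p. pre_digraph.awalk (with_proj (relabel f G)) (f u) p (f v) \<and> length p = k"
      using awalk_relabel[of G u _ v f] by (metis length_map)
  qed
  then show ?thesis
    by (simp add: graph_dist_def)
qed

lemma pair_graph_relabel:
  assumes "pair_graph G" "inj_on f (pverts G)"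
  shows "pair_graph (relabel f G)"
proof -
  interpret pair_graph G by fact
  interpret r: pair_wf_digraph "relabel f G"
    by (rule pair_wf_relabel) unfold_locales
  show ?thesis
  proof unfold_locales
    show "finite (pverts (relabel f G))" "finite (parcs (relabel f G))"
      by simp_all
    show "fst e \<noteq> snd e" if "e \<in> parcs (relabel f G)" for e
      using that assms(2) no_loops' in_arcsD1 in_arcsD2 by (fastforce dest: inj_onD)
    show "symmetric (with_proj (relabel f G))"
      unfolding symmetric_def with_proj_simps
      by (rule symI) (force dest: arcs_symmetric)
  qed
qed

lemma (in pair_graph) connected_iff_strongly_connected:
  "Digraph_Component.connected (with_proj G) \<longleftrightarrow> strongly_connected (with_proj G)"
  using reachable_mk_symmetric_eq[OF sym_arcs]
  by (simp add: Digraph_Component.connected_def strongly_connected_def)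

lemma connected_relabel:
  assumes "Digraph_Component.connected (with_proj G)" "pair_graph G" "inj_on f (pverts G)"
  shows "Digraph_Component.connected (with_proj (relabel f G))"
proof -
  interpret pair_graph G by fact
  interpret r: pair_graph "relabel f G"
    using assms pair_graph_relabel by blast
  have sc: "strongly_connected (with_proj G)"
    using assms(1) by (simp add: connected_iff_strongly_connected)
  have "strongly_connected (with_proj (relabel f G))"
  proof (rule strongly_connectedI)
    show "verts (with_proj (relabel f G)) \<noteq> {}"
      using sc by (simp add: strongly_connected_def)
    fix x y assume "x \<in> verts (with_proj (relabel f G))" "y \<in> verts (with_proj (relabel f G))"
    then obtain u v where uv: "u \<in> pverts G" "v \<in> pverts G" "x = f u" "y = f v"
      by auto
    then have "u \<rightarrow>\<^sup>*\<^bsub>with_proj G\<^esub> v"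
      using sc by (simp add: strongly_connected_def)
    then obtain p where "awalk u p v"
      by (auto simp: reachable_awalk)
    then show "x \<rightarrow>\<^sup>*\<^bsub>with_proj (relabel f G)\<^esub> y"
      using awalk_relabel[of G u p v f] uv by (auto simp: r.reachable_awalk)
  qed
  then show ?thesis
    by (simp add: r.connected_iff_strongly_connected)
qed

lemma metric_rep_relabel:
  assumes "pair_graph G" "inj_on f (pverts G)" "range w \<subseteq> pverts G" "u \<in> pverts G"
  shows "metric_rep (relabel f G) (f \<circ> w) (f u) = metric_rep G w u"
proof -
  interpret pair_graph G by fact
  have "w i \<in> pverts G" for i
    using assms(3) by blast
  then show ?thesis
    using assms pair_wf_digraph by (simp add: metric_rep_def graph_dist_relabel)
qed

lemma realization_relabel:
  assumes R: "realization S G w" and inj: "inj_on f (pverts G)"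
  shows "realization S (relabel f G) (f \<circ> w)"
proof -
  have G: "pair_graph G" "Digraph_Component.connected (with_proj G)" "inj w"
      "range w \<subseteq> pverts G" "inj_on (metric_rep G w) (pverts G)" "S = metric_rep G w ` pverts G"
    using R by (auto simp: realization_def connected_graph_def resolving_def)
  note rep = metric_rep_relabel[OF G(1) inj G(4)]
  have "inj (f \<circ> w)"
    using G(3,4) inj by (meson comp_inj_on inj_on_subset)
  moreover have "range (f \<circ> w) \<subseteq> f ` pverts G"
    using G(4) by auto
  moreover have "inj_on (metric_rep (relabel f G) (f \<circ> w)) (f ` pverts G)"
    using G(5) by (auto simp: inj_on_def rep)
  moreover have "S = metric_rep (relabel f G) (f \<circ> w) ` f ` pverts G"
    using G(6) by (simp add: image_image rep)
  ultimately show ?thesis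
    using G(1,2) inj pair_graph_relabel connected_relabel
    by (auto simp: realization_def connected_graph_def resolving_def)
qed

lemma realization_nat_relabel:
  fixes G :: "'v pair_pre_digraph"
  assumes "realization S G w"
  obtains f :: "'v \<Rightarrow> nat" where "inj_on f (pverts G)" "realization S (relabel f G) (f \<circ> w)"
proof -
  interpret pair_graph G
    using assms by (simp add: realization_def connected_graph_def)
  obtain f :: "'v \<Rightarrow> nat" where "inj_on f (pverts G)"
    using finite_imp_inj_to_nat_seg pair_finite_verts by blast
  with assms that show thesis
    using realization_relabel by blast
qed

lemma realizableI:
  fixes G :: "'v pair_pre_digraph"
  assumes "realization S G w"
  shows "realizable S"
proof -
  interpret pair_graph G
    using assms by (simp add: realization_def connected_graph_def)
  have "finite S"
    using assms by (simp add: realization_def)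
  with assms show ?thesis
    unfolding realizable_def by (metis realization_nat_relabel)
qed

lemma all_realizations_equivalentD:
  fixes G :: "'u pair_pre_digraph" and G' :: "'v pair_pre_digraph"
  assumes all: "all_realizations_equivalent S"
    and R: "realization S G w" and R': "realization S G' w'"
  shows "equivalent_realizations G w G' w'"
proof -
  obtain f :: "'u \<Rightarrow> nat" where f: "inj_on f (pverts G)" "realization S (relabel f G) (f \<circ> w)"
    using realization_nat_relabel[OF R] .
  obtain g :: "'v \<Rightarrow> nat" where g: "inj_on g (pverts G')" "realization S (relabel g G') (g \<circ> w')"
    using realization_nat_relabel[OF R'] .
  have G: "pair_graph G" "range w \<subseteq> pverts G" and G': "pair_graph G'" "range w' \<subseteq> pverts G'"
    using R R' by (auto simp: realization_def connected_graph_def resolving_def)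
  interpret G: pair_graph G by fact
  interpret G': pair_graph G' by fact
  note rep = metric_rep_relabel[OF G(1) f(1) G(2)] and rep' = metric_rep_relabel[OF G'(1) g(1) G'(2)]
  have arc: "(f u, f v) \<in> map_prod f f ` parcs G \<longleftrightarrow> (u, v) \<in> parcs G"
    if "u \<in> pverts G" "v \<in> pverts G" for u v
    using that f(1) G.in_arcsD1 G.in_arcsD2 by (force simp: inj_on_eq_iff)
  have arc': "(g u, g v) \<in> map_prod g g ` parcs G' \<longleftrightarrow> (u, v) \<in> parcs G'"
    if "u \<in> pverts G'" "v \<in> pverts G'" for u v
    using that g(1) G'.in_arcsD1 G'.in_arcsD2 by (force simp: inj_on_eq_iff)
  obtain h where h: "\<And>x. x \<in> f ` pverts G \<Longrightarrow> h x \<in> g ` pverts G' \<and>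
        metric_rep (relabel f G) (f \<circ> w) x = metric_rep (relabel g G') (g \<circ> w') (h x)"
      and iso: "graph_isomorphism h (relabel f G) (relabel g G')"
    using all f(2) g(2)
    unfolding all_realizations_equivalent_def equivalent_realizations_def by (metis relabel_simps(1))
  define k where "k = inv_into (pverts G') g \<circ> h \<circ> f"
  have k: "k u \<in> pverts G'" "g (k u) = h (f u)" if "u \<in> pverts G" for u
    using that h[of "f u"] by (auto simp: k_def inv_into_into f_inv_into_f)
  have "bij_betw k (pverts G) (pverts G')"
  proof -
    have "bij_betw f (pverts G) (f ` pverts G)"
      using f(1) by (simp add: bij_betw_def)
    moreover have "bij_betw h (f ` pverts G) (g ` pverts G')"
      using iso by (simp add: graph_isomorphism_def)
    moreover have "bij_betw (inv_into (pverts G') g) (g ` pverts G') (pverts G')"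
      using g(1) by (simp add: bij_betw_inv_into bij_betw_def inj_on_inv_into)
    ultimately show ?thesis
      unfolding k_def by (metis bij_betw_trans comp_assoc)
  qed
  moreover have "(u, v) \<in> parcs G \<longleftrightarrow> (k u, k v) \<in> parcs G'"
    if "u \<in> pverts G" "v \<in> pverts G" for u v
    using iso that arc[OF that] arc'[OF k(1)[OF that(1)] k(1)[OF that(2)]]
    by (simp add: graph_isomorphism_def k(2))
  moreover have "metric_rep G w u = metric_rep G' w' (k u)" if "u \<in> pverts G" for u
    using that h[of "f u"] rep[of u] rep'[OF k(1)[OF that]] by (simp add: k(2))
  ultimately show ?thesis
    using k(1) unfolding equivalent_realizations_def graph_isomorphism_def by blast
qed

end

theory Submission
  imports Defs
begin

text \<open>
  Adjacent vertices have representations at maximum distance 1, and a vertex at distance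
  \<open>k > 0\<close> from \<open>w i\<close> has a neighbour at distance \<open>k - 1\<close>. Conversely, these two properties
  of a symmetric relation on a realizable \<open>S\<close> make it the arc set of a realization. Hence all
  pairs at maximum distance 1 form a realization, and such a pair can be deleted from it
  unless it is the only descending arc at one of its ends for some coordinate; in the latter
  case every realization contains it.
\<close>

section \<open>The maximum distance on integer vectors\<close>

lemma max_dist_le_iff: "max_dist x y \<le> c \<longleftrightarrow> (\<forall>i. \<bar>x $ i - y $ i\<bar> \<le> c)"
  by (simp add: max_dist_def)

lemma max_dist_commute: "max_dist x y = max_dist y x"
  by (simp add: max_dist_def abs_minus_commute)

lemma max_dist_eq_1_iff:
  "max_dist x y = 1 \<longleftrightarrow> x \<noteq> y \<and> (\<forall>i. \<bar>x $ i - y $ i\<bar> \<le> 1)"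
proof -
  have "max_dist x y \<le> 0 \<longleftrightarrow> x = y"
    by (simp add: max_dist_le_iff vec_eq_iff)
  moreover have "max_dist x y = 1 \<longleftrightarrow> \<not> max_dist x y \<le> 0 \<and> max_dist x y \<le> 1"
    by linarith
  ultimately show ?thesis
    by (simp add: max_dist_le_iff[of x y 1])
qed

section \<open>Distances in a connected graph\<close>

context pair_graph
begin

lemma graph_dist_le_length:
  assumes "awalk u p v"
  shows "graph_dist G u v \<le> length p"
  using assms unfolding graph_dist_def by (intro Least_le) blast

text \<open>Since arcs are symmetric, connectedness provides a directed walk from \<open>u\<close>
  to \<open>v\<close>, so the \<open>LEAST\<close> in \<open>graph_dist\<close> is attained.\<close>

lemma awalk_of_length_graph_dist:
  assumes "Digraph_Component.connected G" "u \<in> pverts G" "v \<in> pverts G"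
  obtains p where "awalk u p v" "length p = graph_dist G u v"
proof -
  have "strongly_connected G"
    using assms(1) by (simp add: connected_iff_strongly_connected)
  then have "u \<rightarrow>\<^sup>*\<^bsub>with_proj G\<^esub> v"
    using assms(2,3) by (simp add: strongly_connected_def)
  then obtain p where "awalk u p v"
    by (auto simp: reachable_awalk)
  then have "\<exists>k p. awalk u p v \<and> length p = k"
    by blast
  then show thesis
    using that LeastI_ex[of "\<lambda>k. \<exists>p. awalk u p v \<and> length p = k"]
    unfolding graph_dist_def by blast
qed

lemma graph_dist_eq_0_iff:
  assumes "Digraph_Component.connected G" "u \<in> pverts G" "v \<in> pverts G"
  shows "graph_dist G u v = 0 \<longleftrightarrow> u = v"
proof
  assume "graph_dist G u v = 0"
  then show "u = v"
    using awalk_of_length_graph_dist[OF assms] by (metis length_0_conv awalk_Nil_iff)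
next
  assume "u = v"
  then have "awalk u [] v"
    using assms by (simp add: awalk_Nil_iff)
  then show "graph_dist G u v = 0"
    using graph_dist_le_length by fastforce
qed

lemma graph_dist_arc_le:
  assumes "Digraph_Component.connected G" "(u, v) \<in> parcs G" "t \<in> pverts G"
  shows "graph_dist G u t \<le> graph_dist G v t + 1"
proof -
  obtain p where p: "awalk v p t" "length p = graph_dist G v t"
    using awalk_of_length_graph_dist assms in_arcsD2 by metis
  then have "awalk u ((u, v) # p) t"
    using assms(2) by (simp add: awalk_Cons_iff)
  then show ?thesis
    using graph_dist_le_length[of u "(u, v) # p" t] p(2) by simp
qed

lemma graph_dist_descend:
  assumes "Digraph_Component.connected G" "u \<in> pverts G" "t \<in> pverts G" "u \<noteq> t"
  obtains v where "(u, v) \<in> parcs G" "graph_dist G u t = graph_dist G v t + 1"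
proof -
  obtain p where p: "awalk u p t" "length p = graph_dist G u t"
    using awalk_of_length_graph_dist assms by metis
  with assms(4) obtain e q where q: "p = e # q"
    by (cases p) (auto simp: awalk_Nil_iff)
  with p have e: "e \<in> parcs G" "fst e = u" "awalk (snd e) q t"
    by (auto simp: awalk_Cons_iff)
  then have uv: "(u, snd e) \<in> parcs G"
    by (metis prod.collapse)
  \<comment> \<open>The rest \<open>q\<close> of the shortest walk bounds the distance from
    \<open>snd e\<close> above by one less than that from \<open>u\<close>; the arc
    \<open>uv\<close> rules out a larger drop.\<close>
  have "graph_dist G u t = graph_dist G (snd e) t + 1"
    using graph_dist_arc_le[OF assms(1) uv assms(3)] graph_dist_le_length[OF e(3)] p(2) q by simp
  with uv that show thesis by blast
qed

end

section \<open>What a realization says about its set of representations\<close>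

locale realized =
  fixes S :: "(int ^ 'n::finite) set" and G :: "'v pair_pre_digraph" and w :: "'n \<Rightarrow> 'v"
  assumes realization: "realization S G w"

sublocale realized \<subseteq> pair_graph G
  using realization by (simp add: realization_def connected_graph_def)

context realized
begin

lemma
  shows is_connected: "Digraph_Component.connected G"
    and landmark_in_verts [simp]: "w i \<in> pverts G"
    and inj_landmarks: "inj w"
    and inj_on_rep: "inj_on (metric_rep G w) (pverts G)"
    and rep_image: "metric_rep G w ` pverts G = S"
  using realization by (auto simp: realization_def connected_graph_def resolving_def)

lemma rep_in_D:
  assumes "(u, v) \<in> parcs G"
  shows "metric_rep G w v \<in> D S (metric_rep G w u)"
proof -
  have uv: "u \<in> pverts G" "v \<in> pverts G" "u \<noteq> v" and vu: "(v, u) \<in> parcs G"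
    using assms in_arcsD1 in_arcsD2 no_loops' arcs_symmetric by auto
  have "\<bar>metric_rep G w u $ i - metric_rep G w v $ i\<bar> \<le> 1" for i
    using graph_dist_arc_le[OF is_connected assms, of "w i"]
      graph_dist_arc_le[OF is_connected vu, of "w i"]
    by (simp add: metric_rep_def)
  moreover have "metric_rep G w u \<noteq> metric_rep G w v"
    using uv inj_on_rep by (auto dest: inj_onD)
  ultimately show ?thesis
    using uv rep_image by (auto simp: D_def max_dist_eq_1_iff)
qed

lemma rep_descend:
  assumes "u \<in> pverts G" "metric_rep G w u $ i \<noteq> 0"
  obtains v where "(u, v) \<in> parcs G" "metric_rep G w v $ i = metric_rep G w u $ i - 1"
proof -
  have "u \<noteq> w i"
    using assms graph_dist_eq_0_iff[OF is_connected, of u "w i"] by (auto simp: metric_rep_def)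
  then obtain v where "(u, v) \<in> parcs G" "graph_dist G u (w i) = graph_dist G v (w i) + 1"
    using graph_dist_descend[OF is_connected assms(1) landmark_in_verts] by blast
  then show thesis
    using that by (simp add: metric_rep_def)
qed

text \<open>Some neighbour of \<open>v\<close> must be one step closer to \<open>w i\<close>. Its
  representation lies in the set in \<open>unique\<close>, so it equals that of \<open>u\<close>,
  and resolvability makes the neighbour \<open>u\<close> itself.\<close>

lemma arc_if_unique_descent:
  assumes uv: "u \<in> pverts G" "v \<in> pverts G"
    and unique: "{z \<in> D S (metric_rep G w v). z $ i = metric_rep G w v $ i - 1} = {metric_rep G w u}"
  shows "(u, v) \<in> parcs G"
proof -
  have "metric_rep G w u $ i = metric_rep G w v $ i - 1"
    using unique by blast
  \<comment> \<open>Otherwise the coordinate of \<open>u\<close> would be -1, but it is a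
    distance.\<close>
  then have "metric_rep G w v $ i \<noteq> 0"
    by (simp add: metric_rep_def)
  then obtain t where t: "(v, t) \<in> parcs G" "metric_rep G w t $ i = metric_rep G w v $ i - 1"
    using rep_descend uv(2) by blast
  then have "metric_rep G w t = metric_rep G w u"
    using rep_in_D unique by blast
  then have "t = u"
    using inj_on_rep uv(1) t(1) in_arcsD2 by (auto dest: inj_onD)
  with t(1) show ?thesis
    by (simp add: arcs_symmetric)
qed

text \<open>Under \<open>descents\<close> the arcs can be read off from the representations alone,
  by a rule in which the realization does not occur.\<close>

lemma arc_iff_max_dist_eq_1:
  assumes descents: "\<forall>x\<in>S. \<forall>y\<in>S. max_dist x y = 1 \<longrightarrow>
      (\<exists>i. (x $ i < y $ i \<and> {z \<in> D S y. z $ i = y $ i - 1} = {x}) \<or>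
           (y $ i < x $ i \<and> {z \<in> D S x. z $ i = x $ i - 1} = {y}))"
    and uv: "u \<in> pverts G" "v \<in> pverts G"
  shows "(u, v) \<in> parcs G \<longleftrightarrow> max_dist (metric_rep G w u) (metric_rep G w v) = 1"
proof
  assume "(u, v) \<in> parcs G"
  then show "max_dist (metric_rep G w u) (metric_rep G w v) = 1"
    using rep_in_D by (simp add: D_def)
next
  assume "max_dist (metric_rep G w u) (metric_rep G w v) = 1"
  moreover have "metric_rep G w u \<in> S" "metric_rep G w v \<in> S"
    using uv rep_image by auto
  ultimately show "(u, v) \<in> parcs G"
    using descents arc_if_unique_descent uv arcs_symmetric by meson
qed

section \<open>Graphs whose vertices are the points of \<open>S\<close>\<close>

abbreviation landmark_rep :: "'n \<Rightarrow> int ^ 'n" where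
  "landmark_rep i \<equiv> metric_rep G w (w i)"

lemma landmark_rep_in: "landmark_rep i \<in> S"
  using rep_image by auto

lemma inj_landmark_rep: "inj landmark_rep"
  using inj_on_rep inj_landmarks by (simp add: inj_def inj_on_eq_iff)

text \<open>Characterizes the landmark points by \<open>S\<close> alone, so they can serve as
  landmarks for other arc sets on \<open>S\<close>.\<close>

lemma coordinate_eq_0_iff:
  assumes "x \<in> S"
  shows "x $ i = 0 \<longleftrightarrow> x = landmark_rep i"
proof -
  obtain u where u: "u \<in> pverts G" "x = metric_rep G w u"
    using assms rep_image by blast
  have "x $ i = 0 \<longleftrightarrow> graph_dist G u (w i) = 0"
    by (simp add: u(2) metric_rep_def)
  also have "\<dots> \<longleftrightarrow> u = w i"
    using graph_dist_eq_0_iff is_connected u(1) by simp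
  also have "\<dots> \<longleftrightarrow> x = landmark_rep i"
    using inj_on_rep u by (simp add: inj_on_eq_iff)
  finally show ?thesis .
qed

lemma coordinate_nonneg: "x \<in> S \<Longrightarrow> 0 \<le> x $ i"
  using rep_image by (auto simp: metric_rep_def)

lemma coordinate_descend:
  assumes "x \<in> S" "x $ i \<noteq> 0"
  obtains z where "z \<in> D S x" "z $ i = x $ i - 1"
proof -
  obtain u where u: "u \<in> pverts G" "x = metric_rep G w u"
    using assms(1) rep_image by blast
  then obtain v where "(u, v) \<in> parcs G" "metric_rep G w v $ i = x $ i - 1"
    using rep_descend assms(2) by blast
  with u(2) show thesis
    using that rep_in_D by metis
qed

text \<open>Every point becomes its own representation. Descending arcs give a walk of length
  \<open>x $ i\<close> to landmark \<open>i\<close>, and no walk is shorter because an arc changes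
  each coordinate by at most 1.\<close>

lemma realization_on_points:
  assumes E: "E \<subseteq> (SIGMA x:S. D S x)" "sym E"
    and descend: "\<forall>x\<in>S. \<forall>i. x $ i \<noteq> 0 \<longrightarrow> (\<exists>z. (x, z) \<in> E \<and> z $ i = x $ i - 1)"
  defines "K \<equiv> \<lparr>pverts = S, parcs = E\<rparr>"
  shows "realization S K landmark_rep"
    and "x \<in> S \<Longrightarrow> metric_rep K landmark_rep x = x"
proof -
  have arcD: "x \<in> S" "y \<in> S" "max_dist x y = 1" if "(x, y) \<in> E" for x y
    using E(1) that by (auto simp: D_def)
  have fin: "finite S"
    using rep_image by auto
  have K: "pverts K = S" "parcs K = E"
    by (simp_all add: K_def)
  interpret K: pair_graph K
  proof unfold_locales
    have "E \<subseteq> S \<times> S"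
      using arcD by auto
    then show "finite (parcs K)"
      using fin by (simp add: K finite_subset)
    show "fst e \<noteq> snd e" if "e \<in> parcs K" for e
      using that arcD(3)[of "fst e" "snd e"] by (auto simp: K max_dist_eq_1_iff)
    show "symmetric (with_proj K)"
      using E(2) by (simp add: K symmetric_def)
    show "fst e \<in> pverts K" "snd e \<in> pverts K" if "e \<in> parcs K" for e
      using that arcD[of "fst e" "snd e"] by (simp_all add: K)
  qed (use fin in \<open>simp add: K\<close>)
  \<comment> \<open>Descend along coordinate \<open>i\<close> until it is 0, which happens only at
    \<open>landmark_rep i\<close>.\<close>
  have walk: "\<exists>p. K.awalk x p (landmark_rep i) \<and> length p = k"
    if "x \<in> S" "x $ i = int k" for x i k
    using that
  proof (induction k arbitrary: x)
    case 0
    then have "K.awalk x [] (landmark_rep i)"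
      using coordinate_eq_0_iff[of x i] by (simp add: K.awalk_Nil_iff K)
    then show ?case
      by force
  next
    case (Suc k)
    then have "x $ i \<noteq> 0"
      by simp
    with Suc.prems(1) obtain z where z: "(x, z) \<in> E" "z $ i = x $ i - 1"
      using descend by blast
    then obtain p where "K.awalk z p (landmark_rep i)" "length p = k"
      using Suc.IH[OF arcD(2)[OF z(1)]] Suc.prems(2) by auto
    then have "K.awalk x ((x, z) # p) (landmark_rep i) \<and> length ((x, z) # p) = Suc k"
      using z(1) by (simp add: K.awalk_Cons_iff K)
    then show ?case
      by blast
  qed
  have lower: "x $ i \<le> int (length p)" if "K.awalk x p (landmark_rep i)" for x p i
    using that
  proof (induction p arbitrary: x)
    case Nil
    then show ?case
      using coordinate_eq_0_iff[OF landmark_rep_in, of i i] by (simp add: K.awalk_Nil_iff)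
  next
    case (Cons e p)
    then have "(x, snd e) \<in> E" "K.awalk (snd e) p (landmark_rep i)"
      by (auto simp: K.awalk_Cons_iff K)
    then have "\<bar>x $ i - snd e $ i\<bar> \<le> 1" "snd e $ i \<le> int (length p)"
      using arcD(3)[of x "snd e"] Cons.IH[of "snd e"] by (simp_all add: max_dist_eq_1_iff)
    then show ?case
      by simp
  qed
  have dist: "int (graph_dist K x (landmark_rep i)) = x $ i" if x: "x \<in> S" for x i
  proof -
    obtain p where p: "K.awalk x p (landmark_rep i)" "length p = nat (x $ i)"
      using walk[OF x, of i "nat (x $ i)"] coordinate_nonneg[OF x] by auto
    have "graph_dist K x (landmark_rep i) = nat (x $ i)"
      unfolding graph_dist_def
    proof (rule Least_equality)
      show "\<exists>p. K.awalk x p (landmark_rep i) \<and> length p = nat (x $ i)"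
        using p by blast
    qed (use lower in force)
    then show ?thesis
      using coordinate_nonneg[OF x] by simp
  qed
  show rep: "metric_rep K landmark_rep x = x" if "x \<in> S" for x
    using dist[OF that] by (simp add: metric_rep_def[of K] vec_eq_iff)
  have "strongly_connected (with_proj K)"
  proof (rule strongly_connectedI)
    show "verts (with_proj K) \<noteq> {}"
      using landmark_rep_in by (auto simp: K)
    fix x y assume xy: "x \<in> verts (with_proj K)" "y \<in> verts (with_proj K)"
    \<comment> \<open>\<open>undefined\<close> is just some index, as index types are nonempty. All
      points reach this one landmark, and by symmetry it reaches all of them.\<close>
    have to_landmark: "z \<rightarrow>\<^sup>*\<^bsub>with_proj K\<^esub> landmark_rep undefined" if z: "z \<in> S" for z
      using walk[OF z, of undefined "nat (z $ undefined)"] coordinate_nonneg[OF z]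
      by (auto simp: K.reachable_awalk)
    have "x \<rightarrow>\<^sup>*\<^bsub>with_proj K\<^esub> landmark_rep undefined"
        "landmark_rep undefined \<rightarrow>\<^sup>*\<^bsub>with_proj K\<^esub> y"
      using xy to_landmark symmetric_reachable[OF K.sym_arcs] by (simp_all add: K)
    then show "x \<rightarrow>\<^sup>*\<^bsub>with_proj K\<^esub> y"
      by (rule K.reachable_trans)
  qed
  then have "connected_graph K"
    using K.pair_graph_axioms K.connected_iff_strongly_connected by (simp add: connected_graph_def)
  then show "realization S K landmark_rep"
    using inj_landmark_rep landmark_rep_in rep K(1)
    by (auto simp: realization_def resolving_def inj_on_def image_iff)
qed

end

section \<open>Comparing realizations of the same set\<close>

lemma equivalent_realizationsI:
  assumes R: "realization S G w" and R': "realization S G' w'"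
    and arc: "\<And>u v. u \<in> pverts G \<Longrightarrow> v \<in> pverts G \<Longrightarrow>
      (u, v) \<in> parcs G \<longleftrightarrow> P (metric_rep G w u) (metric_rep G w v)"
    and arc': "\<And>u v. u \<in> pverts G' \<Longrightarrow> v \<in> pverts G' \<Longrightarrow>
      (u, v) \<in> parcs G' \<longleftrightarrow> P (metric_rep G' w' u) (metric_rep G' w' v)"
  shows "equivalent_realizations G w G' w'"
proof -
  interpret G: realized S G w by unfold_locales fact
  interpret G': realized S G' w' by unfold_locales fact
  \<comment> \<open>Both representation maps are bijections onto \<open>S\<close>; going up one and
    down the other preserves representations, and hence every relation \<open>P\<close> on
    them.\<close>
  let ?f = "inv_into (pverts G') (metric_rep G' w') \<circ> metric_rep G w"
  have bij: "bij_betw ?f (pverts G) (pverts G')"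
  proof (rule bij_betw_trans)
    show "bij_betw (metric_rep G w) (pverts G) S"
      using G.inj_on_rep G.rep_image by (simp add: bij_betw_def)
    show "bij_betw (inv_into (pverts G') (metric_rep G' w')) S (pverts G')"
      using G'.inj_on_rep G'.rep_image by (intro bij_betw_inv_into) (simp add: bij_betw_def)
  qed
  have f: "?f u \<in> pverts G'" "metric_rep G' w' (?f u) = metric_rep G w u" if "u \<in> pverts G" for u
  proof -
    show "?f u \<in> pverts G'"
      using that bij bij_betwE by blast
    have "metric_rep G w u \<in> metric_rep G' w' ` pverts G'"
      using that G.rep_image G'.rep_image by auto
    then show "metric_rep G' w' (?f u) = metric_rep G w u"
      by (simp add: f_inv_into_f)
  qed
  have "(u, v) \<in> parcs G \<longleftrightarrow> (?f u, ?f v) \<in> parcs G'" if "u \<in> pverts G" "v \<in> pverts G" for u v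
    using that arc arc' f by metis
  with bij f show ?thesis
    unfolding equivalent_realizations_def graph_isomorphism_def by (intro exI[of _ ?f]) auto
qed

theorem theorem2p4:
  fixes S :: "(int ^ 'n::finite) set"
  assumes "realizable S"
  shows "all_realizations_equivalent S \<longleftrightarrow>
    (\<forall>x\<in>S. \<forall>y\<in>S. max_dist x y = 1 \<longrightarrow>
      (\<exists>i. (x $ i < y $ i \<and> {z \<in> D S y. z $ i = y $ i - 1} = {x}) \<or>
           (y $ i < x $ i \<and> {z \<in> D S x. z $ i = x $ i - 1} = {y})))"
    (is "_ \<longleftrightarrow> ?descents")
proof
  assume descents: ?descents
  show "all_realizations_equivalent S"
    unfolding all_realizations_equivalent_def
  proof (intro allI impI)
    fix G G' :: "nat pair_pre_digraph" and w w' :: "'n \<Rightarrow> nat"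
    assume R: "realization S G w" and R': "realization S G' w'"
    from R R' show "equivalent_realizations G w G' w'"
    proof (rule equivalent_realizationsI)
      show "(u, v) \<in> parcs G \<longleftrightarrow> max_dist (metric_rep G w u) (metric_rep G w v) = 1"
        if "u \<in> pverts G" "v \<in> pverts G" for u v
        using realized.arc_iff_max_dist_eq_1[OF realized.intro[OF R] descents that] .
      show "(u, v) \<in> parcs G' \<longleftrightarrow> max_dist (metric_rep G' w' u) (metric_rep G' w' v) = 1"
        if "u \<in> pverts G'" "v \<in> pverts G'" for u v
        using realized.arc_iff_max_dist_eq_1[OF realized.intro[OF R'] descents that] .
    qed
  qed
next
  assume all: "all_realizations_equivalent S"
  obtain G :: "nat pair_pre_digraph" and w :: "'n \<Rightarrow> nat"
    where R: "realization S G w"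
    using assms unfolding realizable_def by blast
  interpret realized S G w
    by unfold_locales fact
  show ?descents
  proof (intro ballI impI, rule ccontr)
    fix x y
    assume xy: "x \<in> S" "y \<in> S" "max_dist x y = 1"
      and none: "\<not> (\<exists>i. (x $ i < y $ i \<and> {z \<in> D S y. z $ i = y $ i - 1} = {x}) \<or>
           (y $ i < x $ i \<and> {z \<in> D S x. z $ i = x $ i - 1} = {y}))"
    define E where "E = (SIGMA u:S. D S u)"
    \<comment> \<open>Both orientations are removed so that \<open>E'\<close> stays
      symmetric.\<close>
    define E' where "E' = E - {(x, y), (y, x)}"
    have sym: "sym E" "sym E'"
      by (auto simp: E'_def E_def D_def sym_def max_dist_commute)
    have descend: "\<exists>z. (u, z) \<in> E \<and> z $ i = u $ i - 1" if u: "u \<in> S" "u $ i \<noteq> 0" for u i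
      using coordinate_descend[OF u] u(1) by (auto simp: E_def)
    have descend': "\<exists>z. (u, z) \<in> E' \<and> z $ i = u $ i - 1" if u: "u \<in> S" "u $ i \<noteq> 0" for u i
    proof -
      \<comment> \<open>Here \<open>b\<close> is the neighbour that \<open>a\<close> loses. Some
        descending \<open>c\<close> exists; were \<open>b\<close> the only one, it would violate the
        third assumption, which \<open>none\<close> supplies for both ends of the deleted
        edge.\<close>
      have other: "\<exists>z\<in>D S a. z $ i = a $ i - 1 \<and> z \<noteq> b"
        if "a \<in> S" "a $ i \<noteq> 0" "\<not> (b $ i < a $ i \<and> {z \<in> D S a. z $ i = a $ i - 1} = {b})" for a b
      proof -
        obtain c where c: "c \<in> D S a" "c $ i = a $ i - 1"
          using coordinate_descend \<open>a \<in> S\<close> \<open>a $ i \<noteq> 0\<close> by blast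
        show ?thesis
        proof (rule ccontr)
          assume "\<not> ?thesis"
          with c have "{z \<in> D S a. z $ i = a $ i - 1} = {b}" "c = b"
            by auto
          with c that(3) show False
            by simp
        qed
      qed
      \<comment> \<open>Needed so that an arc from \<open>x\<close> to some \<open>z\<close> other
        than \<open>y\<close> is not the deleted arc \<open>(y, x)\<close>, and likewise from
        \<open>y\<close>.\<close>
      have "x \<noteq> y"
        using xy(3) by (simp add: max_dist_eq_1_iff)
      consider "u = x" | "u = y" | "u \<noteq> x" "u \<noteq> y"
        by blast
      then show ?thesis
      proof cases
        case 1
        then show ?thesis
          using other[of x y] none u \<open>x \<noteq> y\<close> by (auto simp: E'_def E_def)
      next
        case 2
        then show ?thesis
          using other[of y x] none u \<open>x \<noteq> y\<close> by (auto simp: E'_def E_def)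
      next
        case 3
        then show ?thesis
          using descend[OF u] by (auto simp: E'_def)
      qed
    qed
    let ?K = "\<lparr>pverts = S, parcs = E\<rparr>" and ?K' = "\<lparr>pverts = S, parcs = E'\<rparr>"
    have K: "realization S ?K landmark_rep" "u \<in> S \<Longrightarrow> metric_rep ?K landmark_rep u = u" for u
      using realization_on_points[of E] sym(1) descend by (auto simp: E_def)
    have K': "realization S ?K' landmark_rep" "u \<in> S \<Longrightarrow> metric_rep ?K' landmark_rep u = u" for u
      using realization_on_points[of E'] sym(2) descend' by (auto simp: E_def E'_def)
    \<comment> \<open>The vertices of both graphs are vectors, not natural numbers, so the
      hypothesis is transferred to another vertex type.\<close>
    have "equivalent_realizations ?K landmark_rep ?K' landmark_rep"
      using all_realizations_equivalentD[OF all K(1) K'(1)] .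
    then obtain f where f: "\<And>u. u \<in> S \<Longrightarrow> f u \<in> S \<and> metric_rep ?K landmark_rep u = metric_rep ?K' landmark_rep (f u)"
      and iso: "graph_isomorphism f ?K ?K'"
      unfolding equivalent_realizations_def by auto
    \<comment> \<open>Points represent themselves in both graphs, so the isomorphism is the identity
      on \<open>S\<close> and \<open>E\<close> and \<open>E'\<close> would have to agree at
      \<open>(x, y)\<close>.\<close>
    have "f u = u" if "u \<in> S" for u
      using f[OF that] K(2)[OF that] K'(2)[of "f u"] by simp
    then have "(x, y) \<in> E \<longleftrightarrow> (x, y) \<in> E'"
      using iso xy(1,2) by (simp add: graph_isomorphism_def)
    then show False
      using xy by (simp add: E_def E'_def D_def)
  qed
qed

end
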